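(* Let $p$ be a prime number, $r,n$ positive integers, $Q$ a quadratic form over the free $\mathbb{Z}/(p^r)$-module $(\mathbb{Z}/(p^r))^n$ with associated bilinear form $b$, and $f$ an element of order $p^{r'}$ in the orthogonal group of $Q$, for some $0\leq r'\leq r$. Let $H(p^r,n,Q,f)$ and $H'(p^r,n,-b,f)$ be the left braces described in the context. Then the map $\varphi\colon H(p^r,n,Q,f)\to H'(p^r,n,-b,f)$ defined by $\varphi(\vec{x},\mu)=(\vec{x},\mu-Q(\vec{x}))$ is an isomorphism of left braces.
   Context: A left brace is a set $B$ with two operations $+$ and $\cdot$ such that $(B,+)$ is an abelian group, $(B,\cdot)$ is a group and $a\cdot(b+c)+a=a\cdot b+a\cdot c$ for all $a,b,c\in B$. The lambda map is $\lambda_a(b)=a\cdot b-a$; together with $(B,+)$ it determines the multiplication by $a\cdot b=a+\lambda_a(b)$. A trivial brace is a left brace with $a\cdot b=a+b$; any abelian group is regarded as a trivial brace. An isomorphism of left braces is a bijection preserving $+$ and $\cdot$. The bilinear form associated to $Q$ is $b(\vec{x},\vec{y})=Q(\vec{x}+\vec{y})-Q(\vec{x})-Q(\vec{y})$; the orthogonal group of $Q$ consists of the module automorphisms $f$ with $Q(f(\vec{x}))=Q(\vec{x})$ for all $\vec{x}$. $H(p^r,n,Q,f)$ is the left brace with additive group $(\mathbb{Z}/(p^r))^{n+1}$, elements written $(\vec{x},\mu)$ with $\vec{x}\in(\mathbb{Z}/(p^r))^n$, $\mu\in\mathbb{Z}/(p^r)$, and lambda map $$\lambda_{(\vec{x},\mu)}(\vec{y},\mu')=(f^{q(\vec{x},\mu)}(\vec{y}),\;\mu'+b(\vec{x},f^{q(\vec{x},\mu)}(\vec{y}))),\qquad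 q(\vec{x},\mu)=\mu-Q(\vec{x}).$$ $H'(p^r,n,-b,f)=T\rtimes_\circ S$ is the asymmetric product of the trivial brace $T=(\mathbb{Z}/(p^r))^n$ by the trivial brace $S=\mathbb{Z}/(p^r)$ via $-b$ and $\alpha$, where $\alpha_\mu(\vec{x})=f^\mu(\vec{x})$; that is, the left brace on $T\times S$ with operations $$(\vec{x},\mu)+(\vec{y},\mu')=(\vec{x}+\vec{y},\;\mu+\mu'-b(\vec{x},\vec{y})),\qquad(\vec{x},\mu)\cdot(\vec{y},\mu')=(\vec{x}+f^\mu(\vec{y}),\;\mu+\mu').$$ *)

theory Defs
  imports
    "HOL-Number_Theory.Residues"
    "HOL-Algebra.Module"
    "HOL-Algebra.Bij"
    "HOL-Algebra.Chinese_Remainder"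
    "HOL-Algebra.Multiplicative_Group"
begin

section \<open>Left braces\<close>

text \<open>
  A left brace is carried by the record type \<open>'a ring\<close>: the fields \<open>add\<close>, \<open>zero\<close> form the
  additive group and \<open>mult\<close>, \<open>one\<close> the multiplicative group. (It is not a ring in general;
  in a left brace the two neutral elements coincide.)
\<close>

locale left_brace = abelian_group B + group B for B (structure) +
  assumes brace_distrib:
    "\<lbrakk>a \<in> carrier B; b \<in> carrier B; c \<in> carrier B\<rbrakk>
      \<Longrightarrow> a \<otimes> (b \<oplus> c) \<oplus> a = a \<otimes> b \<oplus> a \<otimes> c"

definition lambda_map :: "('a, 'm) ring_scheme \<Rightarrow> 'a \<Rightarrow> 'a \<Rightarrow> 'a" where
  "lambda_map B a b = a \<otimes>\<^bsub>B\<^esub> b \<ominus>\<^bsub>B\<^esub> a"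

definition brace_iso :: "('a, 'm) ring_scheme \<Rightarrow> ('b, 'k) ring_scheme \<Rightarrow> ('a \<Rightarrow> 'b) set" where
  "brace_iso A B = {h. bij_betw h (carrier A) (carrier B) \<and>
     (\<forall>x \<in> carrier A. \<forall>y \<in> carrier A. h (x \<oplus>\<^bsub>A\<^esub> y) = h x \<oplus>\<^bsub>B\<^esub> h y) \<and>
     (\<forall>x \<in> carrier A. \<forall>y \<in> carrier A. h (x \<otimes>\<^bsub>A\<^esub> y) = h x \<otimes>\<^bsub>B\<^esub> h y)}"

text \<open>The next two constructions use only the additive part of their argument \<open>A\<close>.\<close>

definition trivial_brace :: "('a, 'm) ring_scheme \<Rightarrow> 'a ring" where
  "trivial_brace A =
     \<lparr>carrier = carrier A, monoid.mult = add A, one = \<zero>\<^bsub>A\<^esub>, zero = \<zero>\<^bsub>A\<^esub>, add = add A\<rparr>"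

definition brace_of_lambda :: "('a, 'm) ring_scheme \<Rightarrow> ('a \<Rightarrow> 'a \<Rightarrow> 'a) \<Rightarrow> 'a ring" where
  "brace_of_lambda A lam =
     \<lparr>carrier = carrier A, monoid.mult = (\<lambda>a b. a \<oplus>\<^bsub>A\<^esub> lam a b), one = \<zero>\<^bsub>A\<^esub>,
      zero = \<zero>\<^bsub>A\<^esub>, add = add A\<rparr>"

text \<open>
  The asymmetric product of the left brace \<open>T\<close> by the left brace \<open>S\<close> via
  \<open>\<beta> : T \<times> T \<rightarrow> S\<close> and \<open>\<alpha> : S \<rightarrow> Aut T\<close>.
\<close>

definition asymmetric_product ::
  "('a, 'm) ring_scheme \<Rightarrow> ('b, 'k) ring_scheme \<Rightarrow> ('a \<Rightarrow> 'a \<Rightarrow> 'b) \<Rightarrow> ('b \<Rightarrow> 'a \<Rightarrow> 'a)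
    \<Rightarrow> ('a \<times> 'b) ring" where
  "asymmetric_product T S \<beta> \<alpha> =
     \<lparr>carrier = carrier T \<times> carrier S,
      monoid.mult = (\<lambda>(x, \<mu>) (y, \<nu>). (x \<otimes>\<^bsub>T\<^esub> \<alpha> \<mu> y, \<mu> \<otimes>\<^bsub>S\<^esub> \<nu>)),
      one = (\<one>\<^bsub>T\<^esub>, \<one>\<^bsub>S\<^esub>),
      zero = (\<zero>\<^bsub>T\<^esub>, \<zero>\<^bsub>S\<^esub>),
      add = (\<lambda>(x, \<mu>) (y, \<nu>). (x \<oplus>\<^bsub>T\<^esub> y, \<mu> \<oplus>\<^bsub>S\<^esub> \<nu> \<oplus>\<^bsub>S\<^esub> \<beta> x y))\<rparr>"


section \<open>Quadratic forms on modules\<close>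

text \<open>
  The free module \<open>R\<^sup>n\<close>, with vectors the extensional functions on \<open>{..<n}\<close>. The record
  type of modules extends that of rings; its fields \<open>mult\<close> and \<open>one\<close> play no role.
\<close>

definition free_module :: "('a, 'm) ring_scheme \<Rightarrow> nat \<Rightarrow> ('a, nat \<Rightarrow> 'a) module" where
  "free_module R n =
     \<lparr>carrier = (\<Pi>\<^sub>E i\<in>{..<n}. carrier R), monoid.mult = undefined, one = undefined,
      zero = (\<lambda>i\<in>{..<n}. \<zero>\<^bsub>R\<^esub>),
      add = (\<lambda>x y. \<lambda>i\<in>{..<n}. x i \<oplus>\<^bsub>R\<^esub> y i),
      smult = (\<lambda>a x. \<lambda>i\<in>{..<n}. a \<otimes>\<^bsub>R\<^esub> x i)\<rparr>"

definition polar_form ::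
  "('a, 'm) ring_scheme \<Rightarrow> ('a, 'b, 'k) module_scheme \<Rightarrow> ('b \<Rightarrow> 'a) \<Rightarrow> 'b \<Rightarrow> 'b \<Rightarrow> 'a" where
  "polar_form R M Q x y = Q (x \<oplus>\<^bsub>M\<^esub> y) \<ominus>\<^bsub>R\<^esub> Q x \<ominus>\<^bsub>R\<^esub> Q y"

definition bilinear_form ::
  "('a, 'm) ring_scheme \<Rightarrow> ('a, 'b, 'k) module_scheme \<Rightarrow> ('b \<Rightarrow> 'b \<Rightarrow> 'a) \<Rightarrow> bool" where
  "bilinear_form R M \<beta> \<longleftrightarrow>
     (\<forall>x \<in> carrier M. \<forall>y \<in> carrier M. \<beta> x y \<in> carrier R) \<and>
     (\<forall>x \<in> carrier M. \<forall>y \<in> carrier M. \<forall>z \<in> carrier M.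
        \<beta> (x \<oplus>\<^bsub>M\<^esub> y) z = \<beta> x z \<oplus>\<^bsub>R\<^esub> \<beta> y z \<and>
        \<beta> z (x \<oplus>\<^bsub>M\<^esub> y) = \<beta> z x \<oplus>\<^bsub>R\<^esub> \<beta> z y) \<and>
     (\<forall>a \<in> carrier R. \<forall>x \<in> carrier M. \<forall>y \<in> carrier M.
        \<beta> (a \<odot>\<^bsub>M\<^esub> x) y = a \<otimes>\<^bsub>R\<^esub> \<beta> x y \<and>
        \<beta> x (a \<odot>\<^bsub>M\<^esub> y) = a \<otimes>\<^bsub>R\<^esub> \<beta> x y)"

text \<open>
  The definition valid over any commutative ring, in particular when 2 is not invertible;
  on a free module it describes exactly the maps \<open>x \<mapsto> \<Sum>i\<le>j. c\<^sub>i\<^sub>j x\<^sub>i x\<^sub>j\<close>.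
\<close>

definition quadratic_form ::
  "('a, 'm) ring_scheme \<Rightarrow> ('a, 'b, 'k) module_scheme \<Rightarrow> ('b \<Rightarrow> 'a) \<Rightarrow> bool" where
  "quadratic_form R M Q \<longleftrightarrow>
     (\<forall>x \<in> carrier M. Q x \<in> carrier R) \<and>
     (\<forall>a \<in> carrier R. \<forall>x \<in> carrier M. Q (a \<odot>\<^bsub>M\<^esub> x) = a \<otimes>\<^bsub>R\<^esub> a \<otimes>\<^bsub>R\<^esub> Q x) \<and>
     bilinear_form R M (polar_form R M Q)"

definition module_auto ::
  "('a, 'm) ring_scheme \<Rightarrow> ('a, 'b, 'k) module_scheme \<Rightarrow> ('b \<Rightarrow> 'b) set" where
  "module_auto R M = {f \<in> Bij (carrier M).
     (\<forall>x \<in> carrier M. \<forall>y \<in> carrier M. f (x \<oplus>\<^bsub>M\<^esub> y) = f x \<oplus>\<^bsub>M\<^esub> f y) \<and>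
     (\<forall>a \<in> carrier R. \<forall>x \<in> carrier M. f (a \<odot>\<^bsub>M\<^esub> x) = a \<odot>\<^bsub>M\<^esub> f x)}"

definition orthogonal_group ::
  "('a, 'm) ring_scheme \<Rightarrow> ('a, 'b, 'k) module_scheme \<Rightarrow> ('b \<Rightarrow> 'a) \<Rightarrow> ('b \<Rightarrow> 'b) monoid" where
  "orthogonal_group R M Q = BijGroup (carrier M)
     \<lparr>carrier := {f \<in> module_auto R M. \<forall>x \<in> carrier M. Q (f x) = Q x}\<rparr>"


section \<open>The two left braces\<close>

abbreviation Zmod :: "nat \<Rightarrow> nat \<Rightarrow> int ring" where
  "Zmod p r \<equiv> residue_ring (int p ^ r)"

abbreviation Zvec :: "nat \<Rightarrow> nat \<Rightarrow> nat \<Rightarrow> (int, nat \<Rightarrow> int) module" where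
  "Zvec p r n \<equiv> free_module (Zmod p r) n"

abbreviation polar_Z ::
  "nat \<Rightarrow> nat \<Rightarrow> nat \<Rightarrow> ((nat \<Rightarrow> int) \<Rightarrow> int) \<Rightarrow> (nat \<Rightarrow> int) \<Rightarrow> (nat \<Rightarrow> int) \<Rightarrow> int" where
  "polar_Z p r n Q \<equiv> polar_form (Zmod p r) (Zvec p r n) Q"

abbreviation orth_Z ::
  "nat \<Rightarrow> nat \<Rightarrow> nat \<Rightarrow> ((nat \<Rightarrow> int) \<Rightarrow> int) \<Rightarrow> ((nat \<Rightarrow> int) \<Rightarrow> (nat \<Rightarrow> int)) monoid" where
  "orth_Z p r n Q \<equiv> orthogonal_group (Zmod p r) (Zvec p r n) Q"

text \<open>
  The power of \<open>f\<close> with exponent a residue class modulo \<open>p ^ r\<close>: elements of \<open>Zmod p r\<close> are the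
  representatives \<open>0, \<dots>, p ^ r - 1\<close>, and the choice of representative does not matter when
  the order of \<open>f\<close> divides \<open>p ^ r\<close>.
\<close>

definition orth_pow ::
  "nat \<Rightarrow> nat \<Rightarrow> nat \<Rightarrow> ((nat \<Rightarrow> int) \<Rightarrow> int) \<Rightarrow> ((nat \<Rightarrow> int) \<Rightarrow> (nat \<Rightarrow> int)) \<Rightarrow>
    int \<Rightarrow> (nat \<Rightarrow> int) \<Rightarrow> (nat \<Rightarrow> int)" where
  "orth_pow p r n Q f \<mu> = f [^]\<^bsub>orth_Z p r n Q\<^esub> \<mu>"

definition brace_H ::
  "nat \<Rightarrow> nat \<Rightarrow> nat \<Rightarrow> ((nat \<Rightarrow> int) \<Rightarrow> int) \<Rightarrow> ((nat \<Rightarrow> int) \<Rightarrow> (nat \<Rightarrow> int)) \<Rightarrow>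
    ((nat \<Rightarrow> int) \<times> int) ring" where
  "brace_H p r n Q f = brace_of_lambda (RDirProd (Zvec p r n) (Zmod p r))
     (\<lambda>(x, \<mu>) (y, \<nu>).
        let q = \<mu> \<ominus>\<^bsub>Zmod p r\<^esub> Q x; z = orth_pow p r n Q f q y
        in (z, \<nu> \<oplus>\<^bsub>Zmod p r\<^esub> polar_Z p r n Q x z))"

text \<open>The third argument below is the negated form \<open>- b\<close>.\<close>

definition brace_H' ::
  "nat \<Rightarrow> nat \<Rightarrow> nat \<Rightarrow> ((nat \<Rightarrow> int) \<Rightarrow> int) \<Rightarrow> ((nat \<Rightarrow> int) \<Rightarrow> (nat \<Rightarrow> int)) \<Rightarrow>
    ((nat \<Rightarrow> int) \<times> int) ring" where
  "brace_H' p r n Q f = asymmetric_product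
     (trivial_brace (Zvec p r n)) (trivial_brace (Zmod p r))
     (\<lambda>x y. \<ominus>\<^bsub>Zmod p r\<^esub> polar_Z p r n Q x y) (orth_pow p r n Q f)"

lemma mult_brace_H':
  "(x, \<mu>) \<otimes>\<^bsub>brace_H' p r n Q f\<^esub> (y, \<nu>) =
     (x \<oplus>\<^bsub>Zvec p r n\<^esub> orth_pow p r n Q f \<mu> y, \<mu> \<oplus>\<^bsub>Zmod p r\<^esub> \<nu>)"
  by (simp add: brace_H'_def asymmetric_product_def trivial_brace_def)

lemma add_brace_H':
  "(x, \<mu>) \<oplus>\<^bsub>brace_H' p r n Q f\<^esub> (y, \<nu>) =
     (x \<oplus>\<^bsub>Zvec p r n\<^esub> y, \<mu> \<oplus>\<^bsub>Zmod p r\<^esub> \<nu> \<ominus>\<^bsub>Zmod p r\<^esub> polar_Z p r n Q x y)"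
  by (simp add: brace_H'_def asymmetric_product_def trivial_brace_def a_minus_def)

lemma mult_brace_H:
  "(x, \<mu>) \<otimes>\<^bsub>brace_H p r n Q f\<^esub> (y, \<nu>) =
     (let z = orth_pow p r n Q f (\<mu> \<ominus>\<^bsub>Zmod p r\<^esub> Q x) y
      in (x \<oplus>\<^bsub>Zvec p r n\<^esub> z, \<mu> \<oplus>\<^bsub>Zmod p r\<^esub> (\<nu> \<oplus>\<^bsub>Zmod p r\<^esub> polar_Z p r n Q x z)))"
  by (simp add: brace_H_def brace_of_lambda_def RDirProd_def monoid.defs ring.defs Let_def)

lemma (in left_brace) mult_eq_add_lambda_map:
  assumes "a \<in> carrier B" "b \<in> carrier B"
  shows "a \<otimes> b = a \<oplus> lambda_map B a b"
  using assms by (simp add: lambda_map_def minus_eq a_comm [of "a \<otimes> b"] r_neg2)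

end

theory Submission
  imports Defs
begin

text \<open>
  The second brace \<open>H'\<close> is the first one, \<open>H\<close>, written in the coordinates \<open>(x, q)\<close> with
  \<open>q = \<mu> - Q x\<close>. The exponent of \<open>f\<close> in the lambda map of \<open>H\<close> is this \<open>q\<close>, and \<open>q\<close> is additive
  along products of \<open>H\<close>: a product \<open>(x, \<mu>) (y, \<nu>)\<close> of \<open>H\<close> is
  \<open>(x + z, \<mu> + \<nu> + b x z)\<close> with \<open>z = f\<^sup>q y\<close>, and \<open>b x z\<close> is exactly what the nonadditivity of
  \<open>Q\<close> contributes, so that the new second coordinate is
  \<open>\<mu> + \<nu> - Q x - Q z = (\<mu> - Q x) + (\<nu> - Q y)\<close> because \<open>f\<close> preserves \<open>Q\<close>. Hence in the new
  coordinates the multiplication becomes a semidirect product. The price is paid by the addition,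
  which was componentwise in \<open>H\<close> and now carries the correction \<open>- b x y\<close>.

  Therefore only \<open>H'\<close> has to be shown to be a left brace. Its additive group is
  an extension by the symmetric cocycle \<open>- b\<close>, its multiplicative group is a semidirect product,
  and the brace identity compares \<open>b (x + f\<^sup>\<mu> y) (x + f\<^sup>\<mu> z)\<close> with
  \<open>b y z + b (x + f\<^sup>\<mu> (y + z)) x\<close>; these agree because \<open>b\<close> is biadditive, symmetric and
  \<open>f\<close>-invariant. The axioms for \<open>H\<close> follow by pulling those of \<open>H'\<close> back along the bijection
  (\<open>left_brace_transport\<close>).

  All this uses only an action of the additive group of scalars on the vectors that preserves a map
  with biadditive polarization (\<open>quadratic_action\<close>). The order of \<open>f\<close> is what makes \<open>\<mu> \<mapsto> f\<^sup>\<mu>\<close> such an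
  action of \<open>\<int>/p\<^sup>r\<close>: since it divides \<open>p\<^sup>r\<close>, reducing an exponent modulo \<open>p\<^sup>r\<close> does not change
  the power (\<open>quadratic_action_orth_pow\<close>).
\<close>

section \<open>Transport of left braces\<close>

lemma group_transport:
  fixes G (structure) and H (structure)
  assumes H: "group H"
    and bij: "bij_betw h (carrier G) (carrier H)"
    and closed: "\<And>x y. x \<in> carrier G \<Longrightarrow> y \<in> carrier G \<Longrightarrow> x \<otimes> y \<in> carrier G"
    and one: "\<one> \<in> carrier G" "h \<one> = \<one>\<^bsub>H\<^esub>"
    and hom: "\<And>x y. x \<in> carrier G \<Longrightarrow> y \<in> carrier G \<Longrightarrow> h (x \<otimes> y) = h x \<otimes>\<^bsub>H\<^esub> h y"
  shows "group G"
proof -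
  interpret H: group H by (rule H)
  have h_closed: "h x \<in> carrier H" if "x \<in> carrier G" for x
    using bij that by (rule bij_betwE [THEN bspec])
  have h_eq: "x = y" if "h x = h y" "x \<in> carrier G" "y \<in> carrier G" for x y
    using bij that by (auto simp: bij_betw_def inj_on_def)
  show ?thesis
  proof (rule groupI)
    fix x y z assume "x \<in> carrier G" "y \<in> carrier G" "z \<in> carrier G"
    then show "(x \<otimes> y) \<otimes> z = x \<otimes> (y \<otimes> z)"
      by (intro h_eq) (simp_all add: closed hom h_closed H.m_assoc)
  next
    fix x assume x: "x \<in> carrier G"
    then show "\<one> \<otimes> x = x"
      by (intro h_eq) (simp_all add: closed hom h_closed one)
    have "inv\<^bsub>H\<^esub> h x \<in> h ` carrier G"
      using bij x by (simp add: bij_betw_def h_closed)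
    then obtain y where y: "y \<in> carrier G" "h y = inv\<^bsub>H\<^esub> h x" by auto
    then have "y \<otimes> x = \<one>"
      using x by (intro h_eq) (simp_all add: closed hom h_closed one)
    with y show "\<exists>y\<in>carrier G. y \<otimes> x = \<one>" by blast
  qed (simp_all add: closed one)
qed

text \<open>
  Every identity can be checked after applying the injective map \<open>h\<close>, and inverses are the
  preimages of inverses. The closure and neutral element conditions are separate hypotheses because
  a ring record need not satisfy them by itself.
\<close>

lemma left_brace_transport:
  fixes A (structure) and B (structure)
  assumes B: "left_brace B"
    and iso: "h \<in> brace_iso A B"
    and add_closed: "\<And>x y. x \<in> carrier A \<Longrightarrow> y \<in> carrier A \<Longrightarrow> x \<oplus> y \<in> carrier A"
    and mult_closed: "\<And>x y. x \<in> carrier A \<Longrightarrow> y \<in> carrier A \<Longrightarrow> x \<otimes> y \<in> carrier A"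
    and zero: "\<zero> \<in> carrier A" "h \<zero> = \<zero>\<^bsub>B\<^esub>"
    and one: "\<one> \<in> carrier A" "h \<one> = \<one>\<^bsub>B\<^esub>"
  shows "left_brace A"
proof -
  interpret B: left_brace B by (rule B)
  have bij: "bij_betw h (carrier A) (carrier B)"
    and h_add: "\<And>x y. x \<in> carrier A \<Longrightarrow> y \<in> carrier A \<Longrightarrow> h (x \<oplus> y) = h x \<oplus>\<^bsub>B\<^esub> h y"
    and h_mult: "\<And>x y. x \<in> carrier A \<Longrightarrow> y \<in> carrier A \<Longrightarrow> h (x \<otimes> y) = h x \<otimes>\<^bsub>B\<^esub> h y"
    using iso by (auto simp: brace_iso_def)
  have h_closed: "h x \<in> carrier B" if "x \<in> carrier A" for x
    using bij that by (rule bij_betwE [THEN bspec])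
  have h_eq: "x = y" if "h x = h y" "x \<in> carrier A" "y \<in> carrier A" for x y
    using bij that by (auto simp: bij_betw_def inj_on_def)
  have "group (add_monoid A)"
    by (rule group_transport [OF B.a_group, of h])
      (use bij in \<open>simp_all add: add_closed zero h_add\<close>)
  moreover have "x \<oplus> y = y \<oplus> x" if "x \<in> carrier A" "y \<in> carrier A" for x y
    using that by (intro h_eq) (simp_all add: add_closed h_add h_closed B.a_comm)
  ultimately have "comm_group (add_monoid A)"
    by (auto intro!: group.group_comm_groupI)
  then have "abelian_group A"
    by (rule comm_group_abelian_groupI)
  moreover have "group A"
    by (rule group_transport [OF B.group_axioms bij mult_closed one h_mult])
  moreover have "a \<otimes> (b \<oplus> c) \<oplus> a = a \<otimes> b \<oplus> a \<otimes> c"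
    if "a \<in> carrier A" "b \<in> carrier A" "c \<in> carrier A" for a b c
    using that
    by (intro h_eq) (simp_all add: add_closed mult_closed h_add h_mult h_closed B.brace_distrib)
  ultimately show ?thesis
    by (simp add: left_brace_def left_brace_axioms_def)
qed


section \<open>Braces from an action preserving a quadratic map\<close>

text \<open>
  With \<open>s = Q (x + y)\<close>, \<open>a = Q x\<close> and \<open>b = Q y\<close>, the last summand on the left is the negative of
  the polar form, so this is the additivity of the second component of \<open>\<phi>\<close>.
\<close>

lemma (in abelian_group) minus_cancel_polar:
  assumes "a \<in> carrier G" "b \<in> carrier G" "s \<in> carrier G" "c \<in> carrier G" "d \<in> carrier G"
  shows "(c \<ominus> a) \<oplus> (d \<ominus> b) \<oplus> \<ominus> (s \<ominus> a \<ominus> b) = c \<oplus> d \<ominus> s"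
proof -
  have cancel: "(u \<ominus> v) \<oplus> v = u" if "u \<in> carrier G" "v \<in> carrier G" for u v
    using that by (simp add: minus_eq a_assoc l_neg)
  have "(c \<ominus> a) \<oplus> (d \<ominus> b) \<oplus> \<ominus> (s \<ominus> a \<ominus> b) =
      ((c \<ominus> a) \<oplus> a) \<oplus> ((d \<ominus> b) \<oplus> b) \<ominus> s"
    using assms by (simp add: minus_eq minus_add a_ac)
  then show ?thesis
    using assms by (simp add: cancel)
qed

text \<open>
  The elements of \<open>S\<close> act on \<open>T\<close>, and they are also the values of \<open>Q\<close>; this is what allows
  \<open>\<alpha> (\<mu> - Q x)\<close> to be formed below. Additivity of the polar form in its second argument follows
  by symmetry.
\<close>

locale quadratic_action = T?: abelian_group T + S: abelian_group S
  for T :: "('a, 'b, 'k) module_scheme" (structure) and S :: "('a, 'm) ring_scheme" +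
  fixes Q :: "'b \<Rightarrow> 'a" and \<alpha> :: "'a \<Rightarrow> 'b \<Rightarrow> 'b"
  assumes Q_closed [simp]: "x \<in> carrier T \<Longrightarrow> Q x \<in> carrier S"
    and polar_add_left: "\<lbrakk>x \<in> carrier T; y \<in> carrier T; z \<in> carrier T\<rbrakk>
      \<Longrightarrow> polar_form S T Q (x \<oplus> y) z = polar_form S T Q x z \<oplus>\<^bsub>S\<^esub> polar_form S T Q y z"
    and \<alpha>_closed [simp]: "\<lbrakk>\<mu> \<in> carrier S; x \<in> carrier T\<rbrakk> \<Longrightarrow> \<alpha> \<mu> x \<in> carrier T"
    and \<alpha>_add: "\<lbrakk>\<mu> \<in> carrier S; x \<in> carrier T; y \<in> carrier T\<rbrakk>
      \<Longrightarrow> \<alpha> \<mu> (x \<oplus> y) = \<alpha> \<mu> x \<oplus> \<alpha> \<mu> y"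
    and \<alpha>_zero: "x \<in> carrier T \<Longrightarrow> \<alpha> \<zero>\<^bsub>S\<^esub> x = x"
    and \<alpha>_sum: "\<lbrakk>\<mu> \<in> carrier S; \<nu> \<in> carrier S; x \<in> carrier T\<rbrakk>
      \<Longrightarrow> \<alpha> (\<mu> \<oplus>\<^bsub>S\<^esub> \<nu>) x = \<alpha> \<mu> (\<alpha> \<nu> x)"
    and Q_\<alpha>: "\<lbrakk>\<mu> \<in> carrier S; x \<in> carrier T\<rbrakk> \<Longrightarrow> Q (\<alpha> \<mu> x) = Q x"
begin

abbreviation \<beta> :: "'b \<Rightarrow> 'b \<Rightarrow> 'a" where
  "\<beta> x y \<equiv> \<ominus>\<^bsub>S\<^esub> polar_form S T Q x y"

definition twisted_brace :: "('b \<times> 'a) ring" where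
  "twisted_brace = brace_of_lambda (RDirProd T S)
     (\<lambda>(x, \<mu>) (y, \<nu>).
        let q = \<mu> \<ominus>\<^bsub>S\<^esub> Q x; z = \<alpha> q y
        in (z, \<nu> \<oplus>\<^bsub>S\<^esub> polar_form S T Q x z))"

definition product_brace :: "('b \<times> 'a) ring" where
  "product_brace = asymmetric_product (trivial_brace T) (trivial_brace S) \<beta> \<alpha>"

abbreviation \<phi> :: "'b \<times> 'a \<Rightarrow> 'b \<times> 'a" where
  "\<phi> \<equiv> \<lambda>(x, \<mu>). (x, \<mu> \<ominus>\<^bsub>S\<^esub> Q x)"

lemma polar_closed [simp]:
  "\<lbrakk>x \<in> carrier T; y \<in> carrier T\<rbrakk> \<Longrightarrow> polar_form S T Q x y \<in> carrier S"
  by (simp add: polar_form_def)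

lemma polar_sym:
  "\<lbrakk>x \<in> carrier T; y \<in> carrier T\<rbrakk> \<Longrightarrow> polar_form S T Q x y = polar_form S T Q y x"
  by (simp add: polar_form_def T.a_comm S.minus_eq S.a_ac)

lemma \<beta>_sym: "\<lbrakk>x \<in> carrier T; y \<in> carrier T\<rbrakk> \<Longrightarrow> \<beta> x y = \<beta> y x"
  by (simp add: polar_sym)

lemma \<beta>_add_left: "\<lbrakk>x \<in> carrier T; y \<in> carrier T; z \<in> carrier T\<rbrakk>
    \<Longrightarrow> \<beta> (x \<oplus> y) z = \<beta> x z \<oplus>\<^bsub>S\<^esub> \<beta> y z"
  by (simp add: polar_add_left S.minus_add)

lemma \<beta>_add_right: "\<lbrakk>x \<in> carrier T; y \<in> carrier T; z \<in> carrier T\<rbrakk>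
    \<Longrightarrow> \<beta> z (x \<oplus> y) = \<beta> z x \<oplus>\<^bsub>S\<^esub> \<beta> z y"
  by (metis \<beta>_sym \<beta>_add_left T.a_closed)

lemma \<beta>_zero_left: "x \<in> carrier T \<Longrightarrow> \<beta> \<zero> x = \<zero>\<^bsub>S\<^esub>"
  using \<beta>_add_left [of \<zero> \<zero> x] by simp

lemma \<beta>_\<alpha>:
  "\<lbrakk>\<mu> \<in> carrier S; x \<in> carrier T; y \<in> carrier T\<rbrakk> \<Longrightarrow> \<beta> (\<alpha> \<mu> x) (\<alpha> \<mu> y) = \<beta> x y"
  by (simp add: polar_form_def Q_\<alpha> flip: \<alpha>_add)

lemma \<alpha>_zero_vec: "\<mu> \<in> carrier S \<Longrightarrow> \<alpha> \<mu> \<zero> = \<zero>"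
  using \<alpha>_add [of \<mu> \<zero> \<zero>] by simp

lemma product_brace_simps [simp]:
  "carrier product_brace = carrier T \<times> carrier S"
  "\<zero>\<^bsub>product_brace\<^esub> = (\<zero>, \<zero>\<^bsub>S\<^esub>)"
  "\<one>\<^bsub>product_brace\<^esub> = (\<zero>, \<zero>\<^bsub>S\<^esub>)"
  "(x, \<mu>) \<oplus>\<^bsub>product_brace\<^esub> (y, \<nu>) = (x \<oplus> y, \<mu> \<oplus>\<^bsub>S\<^esub> \<nu> \<oplus>\<^bsub>S\<^esub> \<beta> x y)"
  "(x, \<mu>) \<otimes>\<^bsub>product_brace\<^esub> (y, \<nu>) = (x \<oplus> \<alpha> \<mu> y, \<mu> \<oplus>\<^bsub>S\<^esub> \<nu>)"
  by (simp_all add: product_brace_def asymmetric_product_def trivial_brace_def)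

lemma twisted_brace_simps [simp]:
  "carrier twisted_brace = carrier T \<times> carrier S"
  "\<zero>\<^bsub>twisted_brace\<^esub> = (\<zero>, \<zero>\<^bsub>S\<^esub>)"
  "\<one>\<^bsub>twisted_brace\<^esub> = (\<zero>, \<zero>\<^bsub>S\<^esub>)"
  "(x, \<mu>) \<oplus>\<^bsub>twisted_brace\<^esub> (y, \<nu>) = (x \<oplus> y, \<mu> \<oplus>\<^bsub>S\<^esub> \<nu>)"
  "(x, \<mu>) \<otimes>\<^bsub>twisted_brace\<^esub> (y, \<nu>) =
     (let z = \<alpha> (\<mu> \<ominus>\<^bsub>S\<^esub> Q x) y in (x \<oplus> z, \<mu> \<oplus>\<^bsub>S\<^esub> (\<nu> \<oplus>\<^bsub>S\<^esub> polar_form S T Q x z)))"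
  by (simp_all add: twisted_brace_def brace_of_lambda_def RDirProd_def monoid.defs ring.defs Let_def)

text \<open>
  Biadditivity of \<open>\<beta>\<close> gives the cocycle condition for associativity of the addition, and
  symmetry makes the addition commutative. Invariance under \<open>\<alpha>\<close> is needed for the brace identity.
\<close>

lemma left_brace_product_brace: "left_brace product_brace"
proof -
  have "abelian_group product_brace"
  proof (rule abelian_groupI)
    fix u v w
    assume "u \<in> carrier product_brace" "v \<in> carrier product_brace" "w \<in> carrier product_brace"
    then show "u \<oplus>\<^bsub>product_brace\<^esub> v \<oplus>\<^bsub>product_brace\<^esub> w =
        u \<oplus>\<^bsub>product_brace\<^esub> (v \<oplus>\<^bsub>product_brace\<^esub> w)"
      by (auto simp: \<beta>_add_left \<beta>_add_right T.a_ac S.a_ac)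
  next
    fix u v assume "u \<in> carrier product_brace" "v \<in> carrier product_brace"
    then show "u \<oplus>\<^bsub>product_brace\<^esub> v = v \<oplus>\<^bsub>product_brace\<^esub> u"
      by (auto simp: T.a_ac S.a_ac polar_sym)
  next
    fix u assume "u \<in> carrier product_brace"
    then obtain x \<mu> where u: "u = (x, \<mu>)" "x \<in> carrier T" "\<mu> \<in> carrier S" by auto
    have "(\<ominus> x, \<ominus>\<^bsub>S\<^esub> (\<mu> \<oplus>\<^bsub>S\<^esub> \<beta> (\<ominus> x) x)) \<oplus>\<^bsub>product_brace\<^esub> u = \<zero>\<^bsub>product_brace\<^esub>"
      using u by (simp add: T.l_neg S.a_assoc S.l_neg)
    with u show "\<exists>v\<in>carrier product_brace. v \<oplus>\<^bsub>product_brace\<^esub> u = \<zero>\<^bsub>product_brace\<^esub>"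
      by (intro bexI [where x = "(\<ominus> x, \<ominus>\<^bsub>S\<^esub> (\<mu> \<oplus>\<^bsub>S\<^esub> \<beta> (\<ominus> x) x))"]) simp_all
  qed (auto simp: \<beta>_zero_left)
  moreover have "group product_brace"
  proof (rule groupI)
    fix u v w
    assume "u \<in> carrier product_brace" "v \<in> carrier product_brace" "w \<in> carrier product_brace"
    then show "u \<otimes>\<^bsub>product_brace\<^esub> v \<otimes>\<^bsub>product_brace\<^esub> w =
        u \<otimes>\<^bsub>product_brace\<^esub> (v \<otimes>\<^bsub>product_brace\<^esub> w)"
      by (auto simp: \<alpha>_add \<alpha>_sum T.a_assoc S.a_assoc)
  next
    fix u assume "u \<in> carrier product_brace"
    then obtain x \<mu> where u: "u = (x, \<mu>)" "x \<in> carrier T" "\<mu> \<in> carrier S" by auto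
    have "(\<alpha> (\<ominus>\<^bsub>S\<^esub> \<mu>) (\<ominus> x), \<ominus>\<^bsub>S\<^esub> \<mu>) \<otimes>\<^bsub>product_brace\<^esub> u = \<one>\<^bsub>product_brace\<^esub>"
      using u by (simp add: T.l_neg S.l_neg \<alpha>_zero_vec flip: \<alpha>_add)
    with u show "\<exists>v\<in>carrier product_brace. v \<otimes>\<^bsub>product_brace\<^esub> u = \<one>\<^bsub>product_brace\<^esub>"
      by (intro bexI [where x = "(\<alpha> (\<ominus>\<^bsub>S\<^esub> \<mu>) (\<ominus> x), \<ominus>\<^bsub>S\<^esub> \<mu>)"]) simp_all
  qed (auto simp: \<alpha>_zero)
  moreover have "u \<otimes>\<^bsub>product_brace\<^esub> (v \<oplus>\<^bsub>product_brace\<^esub> w) \<oplus>\<^bsub>product_brace\<^esub> u =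
      u \<otimes>\<^bsub>product_brace\<^esub> v \<oplus>\<^bsub>product_brace\<^esub> u \<otimes>\<^bsub>product_brace\<^esub> w"
    if uvw: "u \<in> carrier product_brace" "v \<in> carrier product_brace" "w \<in> carrier product_brace"
    for u v w
  proof -
    obtain x y z \<mu> \<nu> \<rho> where
      eq: "u = (x, \<mu>)" "v = (y, \<nu>)" "w = (z, \<rho>)"
      and mem: "x \<in> carrier T" "y \<in> carrier T" "z \<in> carrier T"
        "\<mu> \<in> carrier S" "\<nu> \<in> carrier S" "\<rho> \<in> carrier S"
      using uvw by auto
    \<comment> \<open>The second components of both sides differ only in these values of \<open>\<beta>\<close>.\<close>
    have "\<beta> (x \<oplus> \<alpha> \<mu> y) (x \<oplus> \<alpha> \<mu> z) = \<beta> y z \<oplus>\<^bsub>S\<^esub> \<beta> (x \<oplus> \<alpha> \<mu> (y \<oplus> z)) x"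
      using mem
      by (simp add: \<beta>_add_left \<beta>_add_right \<alpha>_add \<beta>_\<alpha> polar_sym [of x "\<alpha> \<mu> z"] S.a_ac)
    with mem show ?thesis
      by (simp add: eq \<alpha>_add T.a_ac S.a_ac)
  qed
  ultimately show ?thesis
    by (simp add: left_brace_def left_brace_axioms_def)
qed

text \<open>
  For sums, \<open>- Q (x + y)\<close> splits into \<open>- Q x - Q y\<close> and the correction \<open>\<beta> x y\<close> in the addition of the
  target. For products, the value of the polar form added in the source cancels
  against the same splitting of \<open>Q (x + z)\<close>, and \<open>Q z = Q y\<close>.
\<close>

lemma \<phi>_brace_iso: "\<phi> \<in> brace_iso twisted_brace product_brace"
proof -
  have "bij_betw \<phi> (carrier T \<times> carrier S) (carrier T \<times> carrier S)"
    by (rule bij_betw_byWitness [where f' = "\<lambda>(x, \<mu>). (x, \<mu> \<oplus>\<^bsub>S\<^esub> Q x)"])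
      (auto simp: S.minus_eq S.a_assoc S.l_neg S.r_neg)
  moreover have "\<phi> (u \<oplus>\<^bsub>twisted_brace\<^esub> v) = \<phi> u \<oplus>\<^bsub>product_brace\<^esub> \<phi> v"
    if "u \<in> carrier T \<times> carrier S" "v \<in> carrier T \<times> carrier S" for u v
    using that by (auto simp: polar_form_def S.minus_cancel_polar)
  moreover have "\<phi> (u \<otimes>\<^bsub>twisted_brace\<^esub> v) = \<phi> u \<otimes>\<^bsub>product_brace\<^esub> \<phi> v"
    if uv: "u \<in> carrier T \<times> carrier S" "v \<in> carrier T \<times> carrier S" for u v
  proof -
    obtain x \<mu> y \<nu> where eq: "u = (x, \<mu>)" "v = (y, \<nu>)"
      and mem: "x \<in> carrier T" "y \<in> carrier T" "\<mu> \<in> carrier S" "\<nu> \<in> carrier S"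
      using uv by auto
    define z where "z = \<alpha> (\<mu> \<ominus>\<^bsub>S\<^esub> Q x) y"
    have z: "z \<in> carrier T" "Q z = Q y"
      using mem by (simp_all add: z_def Q_\<alpha>)
    show ?thesis
      using mem z
      by (simp add: eq Let_def polar_form_def S.minus_eq S.a_ac S.r_neg S.r_neg1 S.r_neg2
          flip: z_def [unfolded S.minus_eq])
  qed
  ultimately show ?thesis
    unfolding brace_iso_def twisted_brace_simps(1) product_brace_simps(1) by blast
qed

lemma left_brace_twisted_brace: "left_brace twisted_brace"
proof (rule left_brace_transport [OF left_brace_product_brace \<phi>_brace_iso])
  have "Q \<zero> = \<zero>\<^bsub>S\<^esub>"
    using \<beta>_zero_left [of \<zero>] by (simp add: polar_form_def S.minus_eq S.r_neg)
  then show "\<phi> \<zero>\<^bsub>twisted_brace\<^esub> = \<zero>\<^bsub>product_brace\<^esub>" "\<phi> \<one>\<^bsub>twisted_brace\<^esub> = \<one>\<^bsub>product_brace\<^esub>"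
    by (simp_all add: S.minus_eq)
qed (auto simp: Let_def)

end


section \<open>Free modules and orthogonal groups\<close>

lemma free_module_simps [simp]:
  "carrier (free_module R n) = (\<Pi>\<^sub>E i\<in>{..<n}. carrier R)"
  "\<zero>\<^bsub>free_module R n\<^esub> = (\<lambda>i\<in>{..<n}. \<zero>\<^bsub>R\<^esub>)"
  "x \<oplus>\<^bsub>free_module R n\<^esub> y = (\<lambda>i\<in>{..<n}. x i \<oplus>\<^bsub>R\<^esub> y i)"
  "a \<odot>\<^bsub>free_module R n\<^esub> x = (\<lambda>i\<in>{..<n}. a \<otimes>\<^bsub>R\<^esub> x i)"
  by (simp_all add: free_module_def)

lemma abelian_group_free_module:
  fixes R (structure)
  assumes "abelian_group R"
  shows "abelian_group (free_module R n)"
proof -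
  interpret abelian_group R by (rule assms)
  show ?thesis
  proof (rule abelian_groupI)
    fix x assume x: "x \<in> carrier (free_module R n)"
    then have "(\<lambda>i\<in>{..<n}. \<ominus> x i) \<oplus>\<^bsub>free_module R n\<^esub> x = \<zero>\<^bsub>free_module R n\<^esub>"
      by (auto simp: PiE_iff l_neg intro!: restrict_ext)
    moreover have "(\<lambda>i\<in>{..<n}. \<ominus> x i) \<in> carrier (free_module R n)"
      using x by (auto simp: PiE_iff)
    ultimately show "\<exists>y\<in>carrier (free_module R n). y \<oplus>\<^bsub>free_module R n\<^esub> x = \<zero>\<^bsub>free_module R n\<^esub>"
      by blast
  qed (auto simp: PiE_iff a_ac extensional_def fun_eq_iff)
qed

text \<open>
  The maps are extensional, so identity, composition and inverse have their usual values only on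
  \<open>carrier M\<close>; they preserve sums and scalar multiples because these stay in \<open>carrier M\<close>.
\<close>

lemma group_orthogonal_group:
  fixes R (structure) and M :: "('a, 'b, 'k) module_scheme"
  assumes add: "\<And>x y. x \<in> carrier M \<Longrightarrow> y \<in> carrier M \<Longrightarrow> x \<oplus>\<^bsub>M\<^esub> y \<in> carrier M"
    and smult: "\<And>a x. a \<in> carrier R \<Longrightarrow> x \<in> carrier M \<Longrightarrow> a \<odot>\<^bsub>M\<^esub> x \<in> carrier M"
  shows "group (orthogonal_group R M Q)"
proof -
  let ?C = "carrier M"
  let ?O = "{f \<in> module_auto R M. \<forall>x \<in> ?C. Q (f x) = Q x}"
  interpret BijGroup: group "BijGroup ?C" by (rule group_BijGroup)
  have "subgroup ?O (BijGroup ?C)"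
  proof (rule BijGroup.subgroupI)
    show "?O \<subseteq> carrier (BijGroup ?C)"
      by (auto simp: BijGroup_def module_auto_def)
    have "(\<lambda>x\<in>?C. x) \<in> ?O"
      by (auto simp: module_auto_def id_Bij add smult)
    then show "?O \<noteq> {}" by blast
  next
    fix f assume f: "f \<in> ?O"
    then have f_Bij: "f \<in> Bij ?C" by (simp add: module_auto_def)
    define g where "g = (\<lambda>x\<in>?C. inv_into ?C f x)"
    have g_mem: "g x \<in> ?C" and fg: "f (g x) = x" if "x \<in> ?C" for x
      using f_Bij that by (auto simp: g_def Bij_def bij_betw_def inv_into_into f_inv_into_f)
    have g_eq: "g y = x" if "f x = y" "x \<in> ?C" for x y
      using f_Bij that by (auto simp: g_def Bij_def bij_betw_def)
    have "g (x \<oplus>\<^bsub>M\<^esub> y) = g x \<oplus>\<^bsub>M\<^esub> g y" if "x \<in> ?C" "y \<in> ?C" for x y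
      using f that by (intro g_eq) (simp_all add: module_auto_def g_mem fg add)
    moreover have "g (a \<odot>\<^bsub>M\<^esub> x) = a \<odot>\<^bsub>M\<^esub> g x" if "a \<in> carrier R" "x \<in> ?C" for a x
      using f that by (intro g_eq) (simp_all add: module_auto_def g_mem fg smult)
    moreover have "Q (g x) = Q x" if "x \<in> ?C" for x
      using f g_mem [OF that] fg [OF that] by force
    ultimately have "g \<in> ?O"
      using restrict_inv_into_Bij [OF f_Bij] by (simp add: module_auto_def g_def)
    then show "inv\<^bsub>BijGroup ?C\<^esub> f \<in> ?O"
      by (simp add: inv_BijGroup f_Bij g_def)
  next
    fix f g assume fg: "f \<in> ?O" "g \<in> ?O"
    then have Bij: "f \<in> Bij ?C" "g \<in> Bij ?C" by (simp_all add: module_auto_def)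
    have "compose ?C f g \<in> ?O"
      using fg Bij_imp_funcset [OF Bij(2), THEN funcset_mem] compose_Bij [OF Bij]
      by (simp add: module_auto_def compose_def add smult)
    then show "f \<otimes>\<^bsub>BijGroup ?C\<^esub> g \<in> ?O"
      by (simp add: BijGroup_def Bij)
  qed
  then show ?thesis
    unfolding orthogonal_group_def
    by (rule subgroup.subgroup_is_group [OF _ group_BijGroup])
qed

lemma orthogonal_group_memD:
  assumes "f \<in> carrier (orthogonal_group R M Q)"
  shows "f \<in> Bij (carrier M)"
    and "x \<in> carrier M \<Longrightarrow> f x \<in> carrier M"
    and "x \<in> carrier M \<Longrightarrow> y \<in> carrier M \<Longrightarrow> f (x \<oplus>\<^bsub>M\<^esub> y) = f x \<oplus>\<^bsub>M\<^esub> f y"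
    and "x \<in> carrier M \<Longrightarrow> Q (f x) = Q x"
  using assms Bij_imp_funcset [of f "carrier M"]
  by (auto simp: orthogonal_group_def module_auto_def)

lemma orthogonal_group_mult_apply:
  assumes "f \<in> carrier (orthogonal_group R M Q)" "g \<in> carrier (orthogonal_group R M Q)"
    and "x \<in> carrier M"
  shows "(f \<otimes>\<^bsub>orthogonal_group R M Q\<^esub> g) x = f (g x)"
  using assms orthogonal_group_memD(1)[OF assms(1)] orthogonal_group_memD(1)[OF assms(2)]
  by (simp add: orthogonal_group_def BijGroup_def compose_def)

lemma (in group) int_pow_mod:
  fixes i m :: int
  assumes "x \<in> carrier G" "int (ord x) dvd m"
  shows "x [^] (i mod m) = x [^] i"
  using assms by (simp add: int_pow_eq dvd_trans [OF _ dvd_minus_mod])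

text \<open>
  Addition in \<open>Zmod p r\<close> adds representatives and reduces them modulo \<open>p ^ r\<close>, so the
  hypothesis on the order of \<open>f\<close> is what turns sums of exponents into products of powers. The
  other conditions on the action hold because all powers of \<open>f\<close> lie in the orthogonal group.
\<close>

lemma quadratic_action_orth_pow:
  fixes p r n :: nat
  assumes m: "1 < int p ^ r"
    and Q: "quadratic_form (Zmod p r) (Zvec p r n) Q"
    and f: "f \<in> carrier (orth_Z p r n Q)"
    and ord: "group.ord (orth_Z p r n Q) f dvd p ^ r"
  shows "quadratic_action (Zvec p r n) (Zmod p r) Q (orth_pow p r n Q f)"
proof -
  let ?V = "Zvec p r n" and ?O = "orth_Z p r n Q"
  interpret R: residues "int p ^ r" "Zmod p r"
    using m by unfold_locales
  interpret V: abelian_group ?V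
    by (rule abelian_group_free_module) (rule R.abelian_group_axioms)
  interpret O: group ?O
    by (rule group_orthogonal_group) (auto simp: PiE_iff simp del: free_module_simps(2))
  have pow_mem: "orth_pow p r n Q f \<mu> \<in> carrier ?O" for \<mu>
    using f by (simp add: orth_pow_def)
  have "int (O.ord f) dvd int p ^ r"
    using ord by (simp flip: of_nat_power)
  then have pow_sum: "orth_pow p r n Q f (\<mu> \<oplus>\<^bsub>Zmod p r\<^esub> \<nu>) =
      orth_pow p r n Q f \<mu> \<otimes>\<^bsub>?O\<^esub> orth_pow p r n Q f \<nu>" for \<mu> \<nu>
    using f by (simp add: orth_pow_def R.res_add_eq O.int_pow_mod O.int_pow_mult)
  show ?thesis
  proof unfold_locales
    fix x assume x: "x \<in> carrier ?V"
    show "orth_pow p r n Q f \<zero>\<^bsub>Zmod p r\<^esub> x = x"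
      using x by (simp add: orth_pow_def R.res_zero_eq orthogonal_group_def BijGroup_def)
  next
    fix \<mu> \<nu> x assume "x \<in> carrier ?V"
    then show "orth_pow p r n Q f (\<mu> \<oplus>\<^bsub>Zmod p r\<^esub> \<nu>) x =
        orth_pow p r n Q f \<mu> (orth_pow p r n Q f \<nu> x)"
      by (simp only: pow_sum orthogonal_group_mult_apply pow_mem)
  qed (use Q orthogonal_group_memD [OF pow_mem] in
      \<open>simp_all only: quadratic_form_def bilinear_form_def\<close>)
qed

theorem proposition6p1:
  fixes p r r' n :: nat
    and Q :: "(nat \<Rightarrow> int) \<Rightarrow> int"
    and f :: "(nat \<Rightarrow> int) \<Rightarrow> (nat \<Rightarrow> int)"
  assumes "prime p" and "r > 0" and "n > 0"
    and "quadratic_form (Zmod p r) (Zvec p r n) Q"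
    and "f \<in> carrier (orth_Z p r n Q)"
    and "r' \<le> r" and "group.ord (orth_Z p r n Q) f = p ^ r'"
  shows "left_brace (brace_H p r n Q f) \<and> left_brace (brace_H' p r n Q f) \<and>
    (\<lambda>(x, \<mu>). (x, \<mu> \<ominus>\<^bsub>Zmod p r\<^esub> Q x)) \<in> brace_iso (brace_H p r n Q f) (brace_H' p r n Q f)"
proof -
  have "1 < int p ^ r"
    using prime_gt_1_nat [OF assms(1)] assms(2) by (simp add: one_less_power)
  then interpret quadratic_action "Zvec p r n" "Zmod p r" Q "orth_pow p r n Q f"
    using assms(4-7) by (intro quadratic_action_orth_pow) (auto intro: le_imp_power_dvd)
  show ?thesis
    using left_brace_twisted_brace left_brace_product_brace \<phi>_brace_iso
    unfolding brace_H_def brace_H'_def twisted_brace_def product_brace_def by blast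
qed

end
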